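(* Let $Z_n$ be the size of the $n$th generation of a Galton--Watson process (started from $Z_0=1$), and let $\mu=\mathbf{E}Z_1$ be the mean of its child distribution, with $0<\mu<\infty$. Let $Z_n^*$ have the $(\alpha,\beta)$-generalized equilibrium distribution of $Z_n$ with $\alpha=\beta=1$. If $Z_1^*\preceq Z_1$, then $Z_n^*\preceq Z_n$ for all $n$, and for all $n$ and all $t>0$, $$\mathbf{P}[Z_n\ge t\mu^n]\le e^{1-t}\qquad\text{and}\qquad \mathbf{P}[Z_n\le t\mu^n]\le t.$$
   Context: For a nonnegative random variable $X$ with $0<\mathbf{E}X<\infty$, the $(1,1)$-generalized equilibrium distribution of $X$ is the law of $VX^{s}$, where $X^{s}$ is the size-bias transform of $X$ (with law determined by $\mathbf{E}[X]\,\mathbf{E}[f(X^{s})]=\mathbf{E}[Xf(X)]$ for all bounded measurable $f$) and $V$ is uniform on $[0,1]$ and independent of $X^{s}$. $X\preceq Y$ denotes the usual stochastic order: $\mathbf{P}[X>t]\le\mathbf{P}[Y>t]$ for all $t\in\mathbb{R}$. In a Galton--Watson process, $Z_{n+1}$ is the sum of $Z_n$ i.i.d. copies of the child distribution (the law of $Z_1$), independent of $Z_n$. *)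

theory Defs
  imports "HOL-Probability.Probability"
begin

(* xi n i is the number of children of the i-th individual of generation n. *)
locale galton_watson = prob_space M for M :: "'a measure" +
  fixes \<xi> :: "nat \<Rightarrow> nat \<Rightarrow> 'a \<Rightarrow> nat" and Z :: "nat \<Rightarrow> 'a \<Rightarrow> nat"
  assumes indep: "indep_vars (\<lambda>_. count_space UNIV) (\<lambda>(n, i). \<xi> n i) UNIV"
    and ident: "\<And>n i. distr M (count_space UNIV) (\<xi> n i) = distr M (count_space UNIV) (\<xi> 0 0)"
    and Z_0: "\<And>\<omega>. \<omega> \<in> space M \<Longrightarrow> Z 0 \<omega> = 1"
    and Z_Suc: "\<And>n \<omega>. \<omega> \<in> space M \<Longrightarrow> Z (Suc n) \<omega> = (\<Sum>i<Z n \<omega>. \<xi> n i \<omega>)"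
begin

lemma Z_1: "\<omega> \<in> space M \<Longrightarrow> Z 1 \<omega> = \<xi> 0 0 \<omega>"
  using Z_Suc[of \<omega> 0] by (simp add: Z_0)

end

definition real_law :: "'a measure \<Rightarrow> ('a \<Rightarrow> nat) \<Rightarrow> real measure" where
  "real_law M X = distr M borel (\<lambda>\<omega>. real (X \<omega>))"

(* S is the law of X^s when L is the law of X. This is meaningful when L is a probability law on
   [0, \<infinity>) with finite positive mean; S then exists and is unique, see the lemmas below. *)
definition is_size_bias :: "real measure \<Rightarrow> real measure \<Rightarrow> bool" where
  "is_size_bias L S \<longleftrightarrow> prob_space S \<and> sets S = sets borel \<and>
     (\<forall>f :: real \<Rightarrow> real. f \<in> borel_measurable borel \<and> bounded (range f) \<longrightarrow>
        (\<integral>x. x \<partial>L) * (\<integral>x. f x \<partial>S) = (\<integral>x. x * f x \<partial>L))"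

(* The product measure encodes the independence of V and X^s. *)
definition is_equilibrium :: "real measure \<Rightarrow> real measure \<Rightarrow> bool" where
  "is_equilibrium L E \<longleftrightarrow> (\<exists>S. is_size_bias L S \<and>
     E = distr (uniform_measure lborel {0..1} \<Otimes>\<^sub>M S) borel (\<lambda>(v, x). v * x))"

definition stoch_le :: "real measure \<Rightarrow> real measure \<Rightarrow> bool" (infix "\<preceq>\<^sub>s\<^sub>t" 50) where
  "A \<preceq>\<^sub>s\<^sub>t B \<longleftrightarrow> (\<forall>t. measure A {t<..} \<le> measure B {t<..})"

lemma is_size_bias_density:
  assumes "prob_space L" and L: "sets L = sets borel" and nonneg: "AE x in L. 0 \<le> x"
    and int: "integrable L (\<lambda>x. x)" and pos: "0 < (\<integral>x. x \<partial>L)"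
  shows "is_size_bias L (density L (\<lambda>x. ennreal (x / (\<integral>x. x \<partial>L))))"
proof -
  let ?m = "\<integral>x. x \<partial>L"
  let ?S = "density L (\<lambda>x. ennreal (x / ?m))"
  have [measurable_cong]: "sets L = sets borel" by (fact L)
  have sp: "space L = UNIV" using sets_eq_imp_space_eq[OF L] by simp
  have nn: "AE x in L. 0 \<le> x / ?m" using nonneg pos by auto
  have "emeasure ?S (space ?S) = (\<integral>\<^sup>+x. ennreal (x / ?m) \<partial>L)"
    by (simp add: emeasure_density sp)
  also have "\<dots> = ennreal (\<integral>x. x / ?m \<partial>L)"
    using int nn by (intro nn_integral_eq_integral) auto
  also have "\<dots> = 1" using pos by simp
  finally have ps: "prob_space ?S" by (rule prob_spaceI)
  have eq: "?m * (\<integral>x. f x \<partial>?S) = (\<integral>x. x * f x \<partial>L)"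
    if "f \<in> borel_measurable borel" for f :: "real \<Rightarrow> real"
  proof -
    have [measurable]: "f \<in> borel_measurable borel" by fact
    have "(\<integral>x. f x \<partial>?S) = (\<integral>x. (x / ?m) * f x \<partial>L)"
      using nn by (subst integral_density) auto
    also have "\<dots> = (\<integral>x. x * f x \<partial>L) / ?m" by simp
    finally show ?thesis using pos by simp
  qed
  show ?thesis unfolding is_size_bias_def using ps eq L by simp
qed

lemma is_size_bias_unique:
  assumes S: "is_size_bias L S" and T: "is_size_bias L T" and pos: "0 < (\<integral>x. x \<partial>L)"
  shows "S = T"
proof (rule measure_eqI)
  show "sets S = sets T" using S T by (simp add: is_size_bias_def)
  fix A assume A: "A \<in> sets S"
  interpret S: prob_space S using S by (simp add: is_size_bias_def)
  interpret T: prob_space T using T by (simp add: is_size_bias_def)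
  have sets: "sets S = sets borel" "sets T = sets borel" using S T by (simp_all add: is_size_bias_def)
  have sp: "space S = UNIV" "space T = UNIV"
    using sets[THEN sets_eq_imp_space_eq] by simp_all
  have "(indicator A :: real \<Rightarrow> real) \<in> borel_measurable borel"
    using A sets by (intro borel_measurable_indicator) auto
  moreover have "bounded (range (indicator A :: real \<Rightarrow> real))"
    by (rule boundedI[of _ 1]) (auto simp: indicator_def)
  ultimately have "(\<integral>x. x \<partial>L) * (\<integral>x. indicator A x \<partial>S) = (\<integral>x. x \<partial>L) * (\<integral>x. indicator A x \<partial>T)"
    using S T unfolding is_size_bias_def by metis
  then have "measure S A = measure T A" using pos A sets sp by simp
  then show "emeasure S A = emeasure T A"
    by (simp add: S.emeasure_eq_measure T.emeasure_eq_measure)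
qed

end

theory Submission
  imports Defs
begin

text \<open>Since \<open>\<^bold>P[X\<^sup>* > t] = \<^bold>E(X - t)\<^sup>+ / \<^bold>E X\<close>, the condition \<open>X\<^sup>* \<preceq> X\<close> says that \<open>X\<close> is ``new better
  than used in expectation'': \<open>\<^bold>E(X - t)\<^sup>+ \<le> \<^bold>E X \<cdot> \<^bold>P[X > t]\<close>, and for integer-valued \<open>X\<close> only integers
  \<open>t = k\<close> matter. This property is stable under random sums \<open>S\<^sub>N\<close> of i.i.d. terms: conditioning on
  \<open>S\<^sub>n\<close> gives \<open>\<^bold>E(S\<^sub>n\<^sub>+\<^sub>1 - k)\<^sup>+ - \<^bold>E(S\<^sub>n - k)\<^sup>+ \<le> \<mu> \<^bold>P[S\<^sub>n\<^sub>+\<^sub>1 > k]\<close>; summing over \<open>n < N\<close> and applying the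
  property of \<open>N\<close> to the increasing sequence \<open>a\<^sub>n = \<^bold>P[S\<^sub>n > k]\<close> yields the bound for \<open>S\<^sub>N\<close>. The upper
  tail comes from the resulting decay \<open>\<^bold>E(X - s)\<^sup>+ \<le> m e\<^sup>-\<^sup>s\<^sup>/\<^sup>m\<close> with \<open>m = \<^bold>E X\<close>, and the lower tail from
  \<open>\<^bold>E(X - t)\<^sup>+ \<ge> m - t\<close>.\<close>

section \<open>The NBUE property and random sums\<close>

text \<open>Subtraction on \<open>nat\<close> truncates, so \<open>x - k\<close> is the excess over
  \<open>k\<close>. Integrals in \<open>ennreal\<close> keep the whole random-sum argument free of
  integrability conditions.\<close>

definition nbue :: "nat pmf \<Rightarrow> bool" where
  "nbue p \<longleftrightarrow> (\<forall>k. (\<integral>\<^sup>+x. of_nat (x - k) \<partial>p) \<le> (\<integral>\<^sup>+x. of_nat x \<partial>p) * emeasure p {k<..})"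

lemma nbue_return_1: "nbue (return_pmf 1)"
  unfolding nbue_def
proof
  fix k
  show "(\<integral>\<^sup>+x. of_nat (x - k) \<partial>return_pmf 1) \<le>
    (\<integral>\<^sup>+x. of_nat x \<partial>return_pmf 1) * emeasure (return_pmf 1) {k<..}"
    by (cases "k = 0") simp_all
qed

text \<open>The law of a sum of \<open>n\<close> independent draws from \<open>q\<close>, built one
  draw at a time; \<open>bind_pmf p (iid_sum_pmf q)\<close> is then the law of a sum with
  \<open>p\<close>-distributed number of terms.\<close>

fun iid_sum_pmf :: "nat pmf \<Rightarrow> nat \<Rightarrow> nat pmf" where
  "iid_sum_pmf q 0 = return_pmf 0"
| "iid_sum_pmf q (Suc n) = bind_pmf (iid_sum_pmf q n) (\<lambda>s. map_pmf (\<lambda>x. s + x) q)"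

lemma mean_iid_sum_pmf:
  "(\<integral>\<^sup>+x. of_nat x \<partial>iid_sum_pmf q n) = of_nat n * (\<integral>\<^sup>+x. of_nat x \<partial>q)"
  by (induction n) (simp_all add: nn_integral_add algebra_simps)

lemma mean_random_sum:
  "(\<integral>\<^sup>+x. of_nat x \<partial>bind_pmf p (iid_sum_pmf q)) = (\<integral>\<^sup>+x. of_nat x \<partial>p) * (\<integral>\<^sup>+x. of_nat x \<partial>q)"
  by (simp add: mean_iid_sum_pmf nn_integral_multc)

lemma emeasure_pmf_UNIV: "A = UNIV \<Longrightarrow> emeasure (measure_pmf p) A = 1"
  using measure_pmf.emeasure_space_1[of p] by simp

text \<open>Condition on the partial sum \<open>s\<close>. If \<open>s\<close> is at most
  \<open>k\<close>, apply \<open>nbue q\<close> at the remaining threshold \<open>k - s\<close>. If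
  \<open>s\<close> exceeds \<open>k\<close>, the excess splits as \<open>(s - k) + x\<close> and the
  tail probability is 1, so equality holds.\<close>

lemma nbue_iid_sum_step:
  assumes "nbue q"
  shows "(\<integral>\<^sup>+y. of_nat (y - k) \<partial>iid_sum_pmf q (Suc n)) \<le>
    (\<integral>\<^sup>+y. of_nat (y - k) \<partial>iid_sum_pmf q n) +
    (\<integral>\<^sup>+x. of_nat x \<partial>q) * emeasure (iid_sum_pmf q (Suc n)) {k<..}"
proof -
  let ?m = "\<integral>\<^sup>+x. of_nat x \<partial>q"
  have *: "(\<integral>\<^sup>+x. of_nat (s + x - k) \<partial>q) \<le> of_nat (s - k) + ?m * emeasure q ((+) s -` {k<..})" for s
  proof (cases "s \<le> k")
    case True
    then have "(+) s -` {k<..} = {k - s<..}" by auto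
    moreover have "s + x - k = x - (k - s)" for x using True by simp
    moreover have "of_nat (s - k) = (0::ennreal)" using True by simp
    ultimately show ?thesis using assms unfolding nbue_def
      by (simp del: diff_diff_right)
  next
    case False
    then have "(+) s -` {k<..} = UNIV" by auto
    then have "emeasure q ((+) s -` {k<..}) = 1" by (rule emeasure_pmf_UNIV)
    moreover have "of_nat (s + x - k) = (of_nat (s - k) + of_nat x :: ennreal)" for x
      using False by (simp flip: of_nat_add)
    ultimately show ?thesis by (simp add: nn_integral_add)
  qed
  have "(\<integral>\<^sup>+y. of_nat (y - k) \<partial>iid_sum_pmf q (Suc n)) =
      (\<integral>\<^sup>+s. (\<integral>\<^sup>+x. of_nat (s + x - k) \<partial>q) \<partial>iid_sum_pmf q n)" by simp
  also have "\<dots> \<le> (\<integral>\<^sup>+s. of_nat (s - k) + ?m * emeasure q ((+) s -` {k<..}) \<partial>iid_sum_pmf q n)"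
    by (intro nn_integral_mono *)
  also have "\<dots> = (\<integral>\<^sup>+s. of_nat (s - k) \<partial>iid_sum_pmf q n) +
      ?m * (\<integral>\<^sup>+s. emeasure q ((+) s -` {k<..}) \<partial>iid_sum_pmf q n)"
    by (simp add: nn_integral_add nn_integral_cmult)
  also have "(\<integral>\<^sup>+s. emeasure q ((+) s -` {k<..}) \<partial>iid_sum_pmf q n) =
      emeasure (iid_sum_pmf q (Suc n)) {k<..}" by simp
  finally show ?thesis .
qed

lemma nbue_iid_sum_bound:
  assumes "nbue q"
  shows "(\<integral>\<^sup>+y. of_nat (y - k) \<partial>iid_sum_pmf q n) \<le>
    (\<integral>\<^sup>+x. of_nat x \<partial>q) * (\<Sum>j<n. emeasure (iid_sum_pmf q (Suc j)) {k<..})"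
proof (induction n)
  case (Suc n)
  show ?case
    using order_trans[OF nbue_iid_sum_step[OF assms] add_right_mono[OF Suc.IH]]
    by (simp only: sum.lessThan_Suc distrib_left)
qed simp

text \<open>Terms are nonnegative, so a partial sum that has passed \<open>k\<close> stays above
  \<open>k\<close>.\<close>

lemma incseq_emeasure_iid_sum: "incseq (\<lambda>n. emeasure (iid_sum_pmf q n) {k<..})"
proof (rule incseq_SucI)
  fix n
  have "emeasure (iid_sum_pmf q n) {k<..} = (\<integral>\<^sup>+s. indicator {k<..} s \<partial>iid_sum_pmf q n)" by simp
  also have "\<dots> \<le> (\<integral>\<^sup>+s. emeasure q ((+) s -` {k<..}) \<partial>iid_sum_pmf q n)"
  proof (intro nn_integral_mono)
    fix s
    have "emeasure q ((+) s -` {k<..}) = 1" if "k < s"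
      using that by (intro emeasure_pmf_UNIV) auto
    then show "indicator {k<..} s \<le> emeasure q ((+) s -` {k<..})"
      by (auto simp: indicator_def)
  qed
  finally show "emeasure (iid_sum_pmf q n) {k<..} \<le> emeasure (iid_sum_pmf q (Suc n)) {k<..}" by simp
qed

lemma sum_of_bool_less: "(\<Sum>j<n. of_bool (i \<le> j)) = (of_nat (n - i) :: 'a::semiring_1)"
proof (induction n)
  case (Suc n)
  then show ?case by (auto simp: Suc_diff_le not_le add.commute simp del: sum_of_bool_eq)
qed simp

text \<open>Writing \<open>a\<close> as a mixture of the indicators of \<open>{i<..}\<close> reduces the claim to the definition
  of \<open>nbue\<close>, one threshold \<open>i\<close> at a time.\<close>

lemma nbue_incseq:
  fixes a :: "nat \<Rightarrow> ennreal"
  assumes p: "nbue p" and inc: "incseq a" and a0: "a 0 = 0" and fin: "\<And>n. a n < \<top>"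
  shows "(\<integral>\<^sup>+n. (\<Sum>j<n. a (Suc j)) \<partial>p) \<le> (\<integral>\<^sup>+n. of_nat n \<partial>p) * (\<integral>\<^sup>+n. a n \<partial>p)"
proof -
  \<comment> \<open>The weights of the mixture are the increments of \<open>a\<close>. Finiteness of
    \<open>a\<close> makes the \<open>ennreal\<close> differences add up again.\<close>
  define d where "d i = a (Suc i) - a i" for i
  have sum: "a n = (\<Sum>i<n. d i)" for n
  proof (induction n)
    case (Suc n)
    have "a (Suc n) = a n + d n" unfolding d_def
      using inc fin by (intro add_diff_inverse_ennreal[symmetric]) (auto simp: incseq_Suc_iff)
    then show ?case using Suc by simp
  qed (simp add: a0)
  have a: "a n = (\<Sum>i. d i * indicator {i<..} n)" for n
    unfolding sum by (subst suminf_finite[of "{..<n}"]) (auto simp: indicator_def)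
  have b: "(\<Sum>j<n. a (Suc j)) = (\<Sum>i. d i * of_nat (n - i))" for n
  proof -
    \<comment> \<open>\<open>a (Suc j)\<close> collects the increments \<open>d i\<close> with i
      \<le> j. After exchanging the sums, \<open>d i\<close> is counted once for each
      \<open>j\<close> with i \<le> j < n, that is \<open>n - i\<close> times.\<close>
    have "(\<Sum>j<n. a (Suc j)) = (\<Sum>j<n. \<Sum>i<n. d i * of_bool (i \<le> j))"
      unfolding sum
      by (intro sum.cong refl sum.mono_neutral_cong_left) auto
    also have "\<dots> = (\<Sum>i<n. d i * of_nat (n - i))"
      by (subst sum.swap) (simp only: sum_of_bool_less flip: sum_distrib_left)
    also have "\<dots> = (\<Sum>i. d i * of_nat (n - i))"
      by (subst suminf_finite[of "{..<n}"]) auto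
    finally show ?thesis .
  qed
  have "(\<integral>\<^sup>+n. (\<Sum>j<n. a (Suc j)) \<partial>p) = (\<Sum>i. d i * (\<integral>\<^sup>+n. of_nat (n - i) \<partial>p))"
    unfolding b by (simp add: nn_integral_suminf nn_integral_cmult)
  also have "\<dots> \<le> (\<Sum>i. d i * ((\<integral>\<^sup>+n. of_nat n \<partial>p) * emeasure p {i<..}))"
    using p by (intro suminf_le mult_left_mono) (auto simp: nbue_def)
  also have "\<dots> = (\<integral>\<^sup>+n. of_nat n \<partial>p) * (\<Sum>i. d i * emeasure p {i<..})"
    by (simp only: mult.left_commute[of "d _"] ennreal_suminf_cmult)
  also have "(\<Sum>i. d i * emeasure p {i<..}) = (\<integral>\<^sup>+n. a n \<partial>p)"
    unfolding a by (simp add: nn_integral_suminf nn_integral_cmult)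
  finally show ?thesis .
qed

lemma nbue_random_sum:
  assumes p: "nbue p" and q: "nbue q"
  shows "nbue (bind_pmf p (iid_sum_pmf q))"
  unfolding nbue_def mean_random_sum
proof
  fix k
  let ?\<mu> = "\<integral>\<^sup>+x. of_nat x \<partial>q" and ?a = "\<lambda>n. emeasure (iid_sum_pmf q n) {k<..}"
  have "(\<integral>\<^sup>+x. of_nat (x - k) \<partial>bind_pmf p (iid_sum_pmf q)) \<le> (\<integral>\<^sup>+n. ?\<mu> * (\<Sum>j<n. ?a (Suc j)) \<partial>p)"
    unfolding nn_integral_bind_pmf by (intro nn_integral_mono nbue_iid_sum_bound q)
  also have "\<dots> = ?\<mu> * (\<integral>\<^sup>+n. (\<Sum>j<n. ?a (Suc j)) \<partial>p)"
    by (simp add: nn_integral_cmult)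
  also have "\<dots> \<le> ?\<mu> * ((\<integral>\<^sup>+n. of_nat n \<partial>p) * (\<integral>\<^sup>+n. ?a n \<partial>p))"
    \<comment> \<open>The sequence starts at 0 because the empty sum is 0 and never exceeds
      \<open>k\<close>.\<close>
    by (intro mult_left_mono nbue_incseq[OF p incseq_emeasure_iid_sum])
       (auto simp: less_top[symmetric] measure_pmf.emeasure_finite)
  finally show "(\<integral>\<^sup>+x. of_nat (x - k) \<partial>bind_pmf p (iid_sum_pmf q)) \<le>
      (\<integral>\<^sup>+x. of_nat x \<partial>p) * ?\<mu> * emeasure (bind_pmf p (iid_sum_pmf q)) {k<..}"
    by (simp add: mult_ac)
qed

section \<open>Laws of random variables as pmfs\<close>

text \<open>Split the event that \<open>Y (X \<omega>) \<omega>\<close> equals \<open>k\<close> by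
  the value \<open>j\<close> of \<open>X\<close>: only \<open>Y j\<close> matters on each piece, so
  independence of \<open>X\<close> from each single \<open>Y j\<close> is enough.\<close>

lemma (in prob_space) distr_bind_pmf:
  fixes X :: "'a \<Rightarrow> nat" and Y :: "nat \<Rightarrow> 'a \<Rightarrow> nat"
  assumes ind: "\<And>j. indep_var (count_space UNIV) X (count_space UNIV) (Y j)"
    and p: "measure_pmf p = distr M (count_space UNIV) X"
    and r: "\<And>j. measure_pmf (r j) = distr M (count_space UNIV) (Y j)"
  shows "measure_pmf (bind_pmf p r) = distr M (count_space UNIV) (\<lambda>\<omega>. Y (X \<omega>) \<omega>)"
proof (rule measure_eqI_countable[of _ UNIV])
  fix k :: nat assume "k \<in> UNIV"
  have X[measurable]: "X \<in> measurable M (count_space UNIV)"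
    using ind[of 0] by (simp add: indep_var_eq)
  have Y[measurable]: "Y j \<in> measurable M (count_space UNIV)" for j
    using ind[of j] by (simp add: indep_var_eq)
  have [measurable]: "(\<lambda>\<omega>. Y (X \<omega>) \<omega>) \<in> measurable M (count_space UNIV)"
    by (rule measurable_compose_countable) measurable
  have "emeasure (bind_pmf p r) {k} = (\<integral>\<^sup>+j. emeasure (r j) {k} \<partial>p)"
    by (rule emeasure_bind_pmf)
  also have "\<dots> = (\<Sum>j. emeasure p {j} * emeasure (r j) {k})"
    by (simp add: nn_integral_measure_pmf nn_integral_count_space_nat emeasure_pmf_single)
  also have "\<dots> = (\<Sum>j. emeasure M {\<omega> \<in> space M. X \<omega> = j \<and> Y j \<omega> = k})"
  proof (intro suminf_cong)
    fix j
    have "prob (X -` {j} \<inter> space M \<inter> (Y j -` {k} \<inter> space M)) =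
        prob (X -` {j} \<inter> space M) * prob (Y j -` {k} \<inter> space M)"
      using indep_varD[OF ind[of j], of "{j}" "{k}"]
      by (simp add: vimage_def Int_def conj_ac)
    moreover have "X -` {j} \<inter> space M \<inter> (Y j -` {k} \<inter> space M) = {\<omega> \<in> space M. X \<omega> = j \<and> Y j \<omega> = k}"
      by auto
    ultimately show "emeasure p {j} * emeasure (r j) {k} = emeasure M {\<omega> \<in> space M. X \<omega> = j \<and> Y j \<omega> = k}"
      unfolding p r by (simp add: emeasure_distr emeasure_eq_measure ennreal_mult)
  qed
  also have "\<dots> = emeasure M (\<Union>j. {\<omega> \<in> space M. X \<omega> = j \<and> Y j \<omega> = k})"
    by (intro suminf_emeasure) (auto simp: disjoint_family_on_def)
  also have "(\<Union>j. {\<omega> \<in> space M. X \<omega> = j \<and> Y j \<omega> = k}) = (\<lambda>\<omega>. Y (X \<omega>) \<omega>) -` {k} \<inter> space M"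
    by auto
  finally show "emeasure (bind_pmf p r) {k} = emeasure (distr M (count_space UNIV) (\<lambda>\<omega>. Y (X \<omega>) \<omega>)) {k}"
    by (simp add: emeasure_distr)
qed simp_all

lemma (in prob_space) obtain_pmf:
  fixes X :: "'a \<Rightarrow> 'b::countable"
  assumes [measurable]: "X \<in> measurable M (count_space UNIV)"
  obtains p where "measure_pmf p = distr M (count_space UNIV) X"
proof -
  let ?D = "distr M (count_space UNIV) X"
  interpret D: prob_space ?D by (rule prob_space_distr) fact
  have "AE x in ?D. measure ?D {x} \<noteq> 0"
    by (subst D.AE_support_countable) (auto intro!: exI[of _ UNIV])
  then have "measure_pmf (Abs_pmf ?D) = ?D"
    by (intro Abs_pmf_inverse) (auto intro: D.prob_space_axioms)
  then show thesis by (rule that)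
qed

section \<open>Laws of the generations\<close>

context galton_watson
begin

lemma measurable_xi[measurable]: "\<xi> n i \<in> measurable M (count_space UNIV)"
  using indep by (auto simp: indep_vars_def)

text \<open>\<open>Z n\<close> as a function of the offspring numbers, to make its independence of later generations
  visible.\<close>

fun generation :: "nat \<Rightarrow> (nat \<times> nat \<Rightarrow> nat) \<Rightarrow> nat" where
  "generation 0 x = 1"
| "generation (Suc n) x = (\<Sum>i<generation n x. x (n, i))"

text \<open>The index set \<open>A\<close> may be larger than the rows before \<open>n\<close>,
  since the induction step uses generation \<open>n\<close> on the index set belonging to
  \<open>Suc n\<close>.\<close>

lemma measurable_generation:
  "{..<n} \<times> UNIV \<subseteq> A \<Longrightarrow> generation n \<in> measurable (PiM A (\<lambda>_. count_space UNIV)) (count_space UNIV)"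
proof (induction n)
  case (Suc n)
  have "{..<n} \<times> UNIV \<subseteq> A" using Suc.prems by auto
  then have [measurable]: "generation n \<in> measurable (PiM A (\<lambda>_. count_space UNIV)) (count_space UNIV)"
    by (rule Suc.IH)
  have mem: "(n, i) \<in> A" for i using Suc.prems by auto
  have [measurable]: "(\<lambda>x. x (n, i)) \<in> measurable (PiM A (\<lambda>_. count_space UNIV)) (count_space UNIV)" for i
    by (rule measurable_component_singleton) (fact mem)
  have "(\<lambda>x. \<Sum>i<generation n x. x (n, i)) \<in> measurable (PiM A (\<lambda>_. count_space UNIV)) (count_space UNIV)"
    by (rule measurable_compose_countable[where f="\<lambda>N x. \<Sum>i<N. x (n, i)" and g="generation n"]) measurable
  then show ?case by simp
next
  case 0
  have "generation 0 = (\<lambda>_. 1)" by (simp add: fun_eq_iff)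
  then show ?case by simp
qed

lemma Z_eq_generation:
  "\<omega> \<in> space M \<Longrightarrow> {..<n} \<times> UNIV \<subseteq> A \<Longrightarrow> Z n \<omega> = generation n (restrict (\<lambda>(n, i). \<xi> n i \<omega>) A)"
proof (induction n)
  case (Suc n)
  then have "{..<n} \<times> UNIV \<subseteq> A" and "(n, i) \<in> A" for i by auto
  then show ?case using Suc by (simp add: Z_Suc)
qed (simp add: Z_0)

lemma indep_var_restrict_compose:
  assumes "A \<inter> B = {}"
    and "f \<in> measurable (PiM A (\<lambda>_. count_space UNIV)) (count_space UNIV)"
    and "g \<in> measurable (PiM B (\<lambda>_. count_space UNIV)) (count_space UNIV)"
  shows "indep_var (count_space UNIV) (\<lambda>\<omega>. f (restrict (\<lambda>(n, i). \<xi> n i \<omega>) A))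
    (count_space UNIV) (\<lambda>\<omega>. g (restrict (\<lambda>(n, i). \<xi> n i \<omega>) B))"
  using indep_var_compose[OF indep_var_restrict[OF indep assms(1)] assms(2,3)]
  by (simp add: comp_def split_def)

lemma distr_sum_xi:
  assumes q: "measure_pmf q = distr M (count_space UNIV) (\<xi> 0 0)"
  shows "measure_pmf (iid_sum_pmf q j) = distr M (count_space UNIV) (\<lambda>\<omega>. \<Sum>i<j. \<xi> n i \<omega>)"
proof (induction j)
  case 0
  show ?case
    by (rule measure_eqI_countable[of _ UNIV])
       (auto simp: emeasure_distr emeasure_space_1 indicator_def)
next
  case (Suc j)
  \<comment> \<open>The old sum and the new term use disjoint index sets. The value \<open>s\<close>
    of the old sum enters the second variable as a constant shift, giving the family
    \<open>Y s\<close> that \<open>distr_bind_pmf\<close> expects.\<close>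
  have ind: "indep_var (count_space UNIV) (\<lambda>\<omega>. \<Sum>i<j. \<xi> n i \<omega>) (count_space UNIV) (\<lambda>\<omega>. s + \<xi> n j \<omega>)" for s
  proof -
    have [measurable]: "(\<lambda>x. x (n, i)) \<in> measurable (PiM ({n} \<times> {..<j}) (\<lambda>_. count_space UNIV)) (count_space UNIV)"
      if "i \<in> {..<j}" for i
      using that by (intro measurable_component_singleton) auto
    have [measurable]: "(\<lambda>x. s + x (n, j)) \<in> measurable (PiM {(n, j)} (\<lambda>_. count_space UNIV)) (count_space UNIV)"
      by (rule measurable_compose[OF measurable_component_singleton]) auto
    have "indep_var (count_space UNIV) (\<lambda>\<omega>. \<Sum>i<j. restrict (\<lambda>(n, i). \<xi> n i \<omega>) ({n} \<times> {..<j}) (n, i))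
       (count_space UNIV) (\<lambda>\<omega>. s + restrict (\<lambda>(n, i). \<xi> n i \<omega>) {(n, j)} (n, j))"
      by (rule indep_var_restrict_compose[where f="\<lambda>x. \<Sum>i<j. x (n, i)" and g="\<lambda>x. s + x (n, j)"])
         (auto)
    then show ?thesis by simp
  qed
  have "measure_pmf (map_pmf ((+) s) q) = distr M (count_space UNIV) (\<lambda>\<omega>. s + \<xi> n j \<omega>)" for s
    unfolding map_pmf_rep_eq q ident[of n j, symmetric]
    by (subst distr_distr) (auto simp: comp_def)
  from distr_bind_pmf[where Y="\<lambda>s \<omega>. s + \<xi> n j \<omega>", OF ind Suc.IH this] show ?case
    by simp
qed

lemma measurable_Z[measurable]: "Z n \<in> measurable M (count_space UNIV)"
proof (induction n)
  case 0
  then show ?case using Z_0 by (simp cong: measurable_cong)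
next
  case (Suc n)
  note [measurable] = Suc
  have "(\<lambda>\<omega>. \<Sum>i<Z n \<omega>. \<xi> n i \<omega>) \<in> measurable M (count_space UNIV)"
    by (rule measurable_compose_countable[where f="\<lambda>N \<omega>. \<Sum>i<N. \<xi> n i \<omega>" and g="Z n"]) measurable
  then show ?case using Z_Suc by (simp cong: measurable_cong)
qed

text \<open>\<open>Z n\<close> depends only on the rows before \<open>n\<close>, hence is
  independent of every partial sum of row \<open>n\<close>. It is replaced by \<open>?G\<close>,
  with which it agrees on \<open>space M\<close>.\<close>

lemma distr_Z_Suc:
  assumes p: "measure_pmf p = distr M (count_space UNIV) (Z n)"
    and q: "measure_pmf q = distr M (count_space UNIV) (\<xi> 0 0)"
  shows "measure_pmf (bind_pmf p (iid_sum_pmf q)) = distr M (count_space UNIV) (Z (Suc n))"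
proof -
  let ?G = "\<lambda>\<omega>. generation n (restrict (\<lambda>(n, i). \<xi> n i \<omega>) ({..<n} \<times> UNIV))"
  have ind: "indep_var (count_space UNIV) ?G (count_space UNIV) (\<lambda>\<omega>. \<Sum>i<j. \<xi> n i \<omega>)" for j
  proof -
    have [measurable]: "(\<lambda>x. x (n, i)) \<in> measurable (PiM ({n} \<times> UNIV) (\<lambda>_. count_space UNIV)) (count_space UNIV)" for i
      by (intro measurable_component_singleton) auto
    have "indep_var (count_space UNIV) ?G
       (count_space UNIV) (\<lambda>\<omega>. \<Sum>i<j. restrict (\<lambda>(n, i). \<xi> n i \<omega>) ({n} \<times> UNIV) (n, i))"
      by (rule indep_var_restrict_compose[where f="generation n" and g="\<lambda>x. \<Sum>i<j. x (n, i)"])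
         (auto intro: measurable_generation)
    then show ?thesis by simp
  qed
  have Z: "Z n \<omega> = ?G \<omega>" if "\<omega> \<in> space M" for \<omega>
    using Z_eq_generation[OF that] by simp
  then have "measure_pmf p = distr M (count_space UNIV) ?G"
    unfolding p by (intro distr_cong) auto
  from distr_bind_pmf[OF ind this distr_sum_xi[OF q]]
  have "measure_pmf (bind_pmf p (iid_sum_pmf q)) = distr M (count_space UNIV) (\<lambda>\<omega>. \<Sum>i<?G \<omega>. \<xi> n i \<omega>)" .
  also have "\<dots> = distr M (count_space UNIV) (Z (Suc n))"
    using Z by (intro distr_cong) (auto simp: Z_Suc)
  finally show ?thesis .
qed

end

section \<open>Equilibrium distributions and the NBUE property\<close>

lemma integrable_monus:
  "integrable (measure_pmf p) real \<Longrightarrow> integrable (measure_pmf p) (\<lambda>x. real (x - k))"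
  by (rule Bochner_Integration.integrable_bound[where f=real]) auto

lemma nbue_iff_integral:
  assumes int: "integrable (measure_pmf p) real"
  shows "nbue p \<longleftrightarrow> (\<forall>k. (\<integral>x. real (x - k) \<partial>p) \<le> (\<integral>x. real x \<partial>p) * measure p {k<..})"
proof -
  have *: "(\<integral>\<^sup>+x. of_nat (x - k) \<partial>p) = ennreal (\<integral>x. real (x - k) \<partial>p)" for k
    using nn_integral_eq_integral[OF integrable_monus[OF int, of k]]
    by (simp add: ennreal_of_nat_eq_real_of_nat)
  have "(\<integral>\<^sup>+x. of_nat x \<partial>p) * emeasure p {k<..} = ennreal ((\<integral>x. real x \<partial>p) * measure p {k<..})" for k
    using *[of 0] by (simp add: measure_pmf.emeasure_eq_measure ennreal_mult)
  then show ?thesis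
    unfolding nbue_def * by (simp add: ennreal_le_iff zero_le_mult_iff)
qed

text \<open>The conditional probability of V x > t. For positive \<open>x\<close> the event is V > t
  / x, and the \<open>max\<close> covers t > x; for other \<open>x\<close> the product is never
  positive.\<close>

lemma emeasure_uniform_mult_greater:
  fixes t x :: real
  assumes "0 \<le> t"
  shows "emeasure (uniform_measure lborel {0..1}) {v. t < v * x} = ennreal (if 0 < x then max 0 (1 - t / x) else 0)"
proof -
  have *: "{0..1} \<inter> {v. t < v * x} = (if 0 < x \<and> t \<le> x then {t / x<..1} else {})"
  proof (cases "0 < x")
    case True
    have less: "t < v * x \<longleftrightarrow> t / x < v" for v
      using True by (rule pos_divide_less_eq[symmetric])
    have le: "t \<le> x \<longleftrightarrow> t / x \<le> 1"
      using True by (rule divide_le_eq_1_pos[symmetric])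
    define y where "y = t / x"
    have "0 \<le> y" using True assms by (simp add: y_def)
    then show ?thesis
      unfolding less le y_def[symmetric] using True by auto
  next
    case False
    then have "v * x \<le> 0" if "0 \<le> v" for v using that by (simp add: mult_nonneg_nonpos)
    then have "\<not> t < v * x" if "0 \<le> v" for v using that assms by (meson not_less order_trans)
    then show ?thesis using False by auto
  qed
  have "emeasure (uniform_measure lborel {0..1}) {v. t < v * x} = emeasure lborel ({0..1} \<inter> {v. t < v * x})"
    by (subst emeasure_uniform_measure) (auto simp: divide_ennreal_def)
  also have "\<dots> = ennreal (if 0 < x then max 0 (1 - t / x) else 0)"
    unfolding * by (auto simp: max_def)
  finally show ?thesis .
qed

lemma prob_space_equilibrium:
  assumes "is_equilibrium L E"
  shows "prob_space E"
proof -
  obtain S where S: "is_size_bias L S"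
    and E: "E = distr (uniform_measure lborel {0..1} \<Otimes>\<^sub>M S) borel (\<lambda>(v, x). v * x)"
    using assms by (auto simp: is_equilibrium_def)
  interpret S: prob_space S using S by (simp add: is_size_bias_def)
  interpret U: prob_space "uniform_measure lborel {0..1::real}"
    by (rule prob_space_uniform_measure) auto
  interpret US: pair_prob_space "uniform_measure lborel {0..1::real}" S ..
  have [measurable_cong]: "sets S = sets borel" using S by (simp add: is_size_bias_def)
  show ?thesis unfolding E by (rule US.prob_space_distr) measurable
qed

text \<open>Integrating out V leaves the size-bias expectation of
  \<open>f x = max 0 (1 - t / x)\<close> (0 for x \<le> 0). As t \<ge> 0, \<open>f\<close> takes
  values in [0, 1] and is an admissible test function; the defining identity then yields the
  expectation of \<open>x * f x\<close>, the excess over \<open>t\<close>.\<close>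

lemma measure_equilibrium_greater:
  assumes E: "is_equilibrium (distr (measure_pmf p) borel real) E" and t: "0 \<le> t"
  shows "(\<integral>x. real x \<partial>p) * measure E {t<..} = (\<integral>x. max 0 (real x - t) \<partial>p)"
proof -
  let ?U = "uniform_measure lborel {0..1::real}" and ?L = "distr (measure_pmf p) borel real"
  obtain S where S: "is_size_bias ?L S" and E: "E = distr (?U \<Otimes>\<^sub>M S) borel (\<lambda>(v, x). v * x)"
    using E by (auto simp: is_equilibrium_def)
  interpret S: prob_space S using S by (simp add: is_size_bias_def)
  interpret U: prob_space ?U by (rule prob_space_uniform_measure) auto
  interpret US: pair_prob_space ?U S ..
  have [measurable_cong]: "sets S = sets borel" using S by (simp add: is_size_bias_def)
  define f where "f x = (if 0 < x then max 0 (1 - t / x) else 0)" for x :: real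
  have f[measurable]: "f \<in> borel_measurable borel" unfolding f_def by measurable
  have f01: "0 \<le> f x" "f x \<le> 1" for x using t by (auto simp: f_def)
  then have "bounded (range f)" by (intro boundedI[of _ 1]) auto
  have "emeasure E {t<..} = emeasure (?U \<Otimes>\<^sub>M S) {z \<in> space (?U \<Otimes>\<^sub>M S). t < fst z * snd z}"
    unfolding E by (subst emeasure_distr) (simp_all add: vimage_def Int_def split_beta conj_commute)
  also have "\<dots> = (\<integral>\<^sup>+x. emeasure ?U ((\<lambda>v. (v, x)) -` {z \<in> space (?U \<Otimes>\<^sub>M S). t < fst z * snd z}) \<partial>S)"
    by (rule US.emeasure_pair_measure_alt2) measurable
  also have "\<dots> = (\<integral>\<^sup>+x. ennreal (f x) \<partial>S)"
    unfolding f_def emeasure_uniform_mult_greater[OF t, symmetric]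
    by (intro nn_integral_cong arg_cong2[where f=emeasure]) (auto simp: space_pair_measure)
  also have "\<dots> = ennreal (\<integral>x. f x \<partial>S)"
    using f01 by (intro nn_integral_eq_integral S.integrable_const_bound[of _ 1]) auto
  finally have "measure E {t<..} = (\<integral>x. f x \<partial>S)"
    using f01 by (simp add: measure_def)
  then have "(\<integral>x. x \<partial>?L) * measure E {t<..} = (\<integral>x. x * f x \<partial>?L)"
    using S[unfolded is_size_bias_def, THEN conjunct2, THEN conjunct2, rule_format, of f] f
      \<open>bounded (range f)\<close> by (simp only:)
  also have "\<dots> = (\<integral>x. real x * f (real x) \<partial>p)"
    by (subst integral_distr) auto
  also have "\<dots> = (\<integral>x. max 0 (real x - t) \<partial>p)"
  proof (intro Bochner_Integration.integral_cong refl)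
    fix x
    show "real x * f (real x) = max 0 (real x - t)"
    proof (cases "x = 0")
      case False
      then have "real x * f (real x) = max (real x * 0) (real x * (1 - t / real x))"
        by (simp add: f_def max_mult_distrib_left)
      then show ?thesis using False by (simp add: right_diff_distrib)
    qed (use t in simp)
  qed
  finally show ?thesis by (simp add: integral_distr)
qed

lemma measure_real_greater:
  "measure (distr (measure_pmf p) borel real) {t<..} = measure p {x. t < real x}"
  by (subst measure_distr) (auto intro!: arg_cong2[where f=measure])

lemma equilibrium_le_iff_nbue:
  assumes int: "integrable (measure_pmf p) real" and pos: "0 < (\<integral>x. real x \<partial>p)"
    and E: "is_equilibrium (distr (measure_pmf p) borel real) E"
  shows "E \<preceq>\<^sub>s\<^sub>t distr (measure_pmf p) borel real \<longleftrightarrow> nbue p"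
proof
  let ?m = "\<integral>x. real x \<partial>p"
  assume le: "E \<preceq>\<^sub>s\<^sub>t distr (measure_pmf p) borel real"
  show "nbue p"
    unfolding nbue_iff_integral[OF int]
  proof
    fix k
    have "(\<integral>x. real (x - k) \<partial>p) = (\<integral>x. max 0 (real x - real k) \<partial>p)"
      by (intro Bochner_Integration.integral_cong refl) (auto simp: max_def)
    also have "\<dots> = ?m * measure E {real k<..}"
      using measure_equilibrium_greater[OF E, of "real k"] by simp
    also have "\<dots> \<le> ?m * measure p {x. real k < real x}"
      using le[unfolded stoch_le_def measure_real_greater, rule_format, of "real k"] pos
      by (intro mult_left_mono) simp_all
    also have "{x. real k < real x} = {k<..}" by auto
    finally show "(\<integral>x. real (x - k) \<partial>p) \<le> ?m * measure p {k<..}" .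
  qed
next
  let ?m = "\<integral>x. real x \<partial>p"
  assume "nbue p"
  then have nbue: "(\<integral>x. real (x - k) \<partial>p) \<le> ?m * measure p {k<..}" for k
    using nbue_iff_integral[OF int] by simp
  show "E \<preceq>\<^sub>s\<^sub>t distr (measure_pmf p) borel real"
    unfolding stoch_le_def measure_real_greater
  proof
    fix t :: real
    show "measure E {t<..} \<le> measure p {x. t < real x}"
    proof (cases "0 \<le> t")
      case True
      \<comment> \<open>On [k, k + 1) the tail of an integer-valued law is constant while the excess
        decreases, so the inequality at \<open>k\<close> implies the one at
        \<open>t\<close>.\<close>
      define k where "k = nat \<lfloor>t\<rfloor>"
      have k: "real k \<le> t" "t < real k + 1" using True unfolding k_def by linarith+
      have set: "{x. t < real x} = {k<..}" using k by auto
      have "?m * measure E {t<..} = (\<integral>x. max 0 (real x - t) \<partial>p)"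
        by (rule measure_equilibrium_greater[OF E True])
      also have "\<dots> \<le> (\<integral>x. real (x - k) \<partial>p)"
        using k by (intro integral_mono' integrable_monus int) auto
      also have "\<dots> \<le> ?m * measure p {x. t < real x}" unfolding set by (rule nbue)
      finally show ?thesis using pos by simp
    next
      case False
      \<comment> \<open>Below 0 the right-hand side is already 1.\<close>
      then have "{x. t < real x} = UNIV" by auto
      then have "measure p {x. t < real x} = 1" by simp
      moreover have "measure E {t<..} \<le> 1"
        using prob_space.prob_le_1[OF prob_space_equilibrium[OF E]] .
      ultimately show ?thesis by simp
    qed
  qed
qed

section \<open>Tail bounds for NBUE laws\<close>

lemma nbue_lower_tail:
  assumes p: "nbue p" and int: "integrable (measure_pmf p) real" and pos: "0 < (\<integral>x. real x \<partial>p)"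
    and t: "0 < t"
  shows "measure p {x. real x \<le> t * (\<integral>x. real x \<partial>p)} \<le> t"
proof -
  let ?m = "\<integral>x. real x \<partial>p"
  \<comment> \<open>Rounding down keeps the event, as integers are at most \<open>t * ?m\<close> iff
    they are at most \<open>k\<close>. NBUE at \<open>k\<close> gives \<open>?m - k\<close> \<le>
    \<open>?m\<close> (1 - P[X \<le> k]), so \<open>?m\<close> P[X \<le> k] \<le> k \<le>
    \<open>t * ?m\<close>.\<close>
  define k where "k = nat \<lfloor>t * ?m\<rfloor>"
  have k: "real k \<le> t * ?m" "t * ?m < real k + 1"
    using mult_pos_pos[OF t pos] unfolding k_def by linarith+
  have "?m - k = (\<integral>x. real x - real k \<partial>p)"
    using int by simp
  also have "\<dots> \<le> (\<integral>x. real (x - k) \<partial>p)"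
    using int by (intro integral_mono integrable_monus) auto
  also have "\<dots> \<le> ?m * measure p {k<..}"
    using p nbue_iff_integral[OF int] by simp
  also have "measure p {k<..} = 1 - measure p (- {k<..})"
    using measure_pmf.prob_compl[of "- {k<..}" p] by (simp add: Compl_eq_Diff_UNIV[symmetric])
  also have "- {k<..} = {x. real x \<le> t * ?m}"
    using k by auto
  finally have "?m * measure p {x. real x \<le> t * ?m} \<le> ?m * t"
    using k by (simp add: algebra_simps)
  then show ?thesis using pos by simp
qed

text \<open>A discrete Gronwall argument: the excess starts at \<open>m\<close> and loses at least
  the fraction \<theta> / m of its value over a stretch \<theta> \<le> 1 from an integer. Unit
  stretches lead to the integer part of \<open>s\<close>, and one fractional stretch to
  \<open>s\<close>.\<close>

lemma nbue_excess_le: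
  assumes p: "nbue p" and int: "integrable (measure_pmf p) real" and pos: "0 < (\<integral>x. real x \<partial>p)"
    and s: "0 \<le> s"
  defines "m \<equiv> \<integral>x. real x \<partial>p"
  shows "(\<integral>x. max 0 (real x - s) \<partial>p) \<le> m * exp (- s / m)"
proof -
  let ?h = "\<lambda>k. \<integral>x. real (x - k) \<partial>p"
  have h0: "0 \<le> ?h k" for k by simp
  \<comment> \<open>Between two integers the excess function is affine, with slope given by a tail probability
    that \<open>nbue\<close> bounds from below.\<close>
  have step: "(\<integral>x. max 0 (real x - (real k + \<theta>)) \<partial>p) \<le> ?h k * exp (- \<theta> / m)"
    if "0 \<le> \<theta>" "\<theta> \<le> 1" for k \<theta>
  proof -
    have "max 0 (real x - (real k + \<theta>)) = real (x - k) - \<theta> * indicator {k<..} x" for x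
      using that by (cases "k < x") (auto simp: of_nat_diff max_def)
    then have "(\<integral>x. max 0 (real x - (real k + \<theta>)) \<partial>p) =
        (\<integral>x. real (x - k) - \<theta> * indicator {k<..} x \<partial>p)" by simp
    also have "\<dots> = ?h k - \<theta> * measure p {k<..}"
      by (subst Bochner_Integration.integral_diff)
         (simp_all add: integrable_monus int measure_pmf.integrable_const_bound[of _ 1])
    also have "\<dots> \<le> ?h k - \<theta> * (?h k / m)"
    proof -
      have "?h k \<le> m * measure p {k<..}"
        using p nbue_iff_integral[OF int] unfolding m_def by simp
      then have "?h k / m \<le> measure p {k<..}"
        using pos unfolding m_def by (simp add: field_simps)
      then have "\<theta> * (?h k / m) \<le> \<theta> * measure p {k<..}"
        using \<open>0 \<le> \<theta>\<close> by (rule mult_left_mono)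
      then show ?thesis by linarith
    qed
    also have "\<dots> = ?h k * (1 + (- \<theta> / m))" by (simp add: algebra_simps)
    \<comment> \<open>1 + y \<le> exp y holds for all real \<open>y\<close>, so it does not matter
      if 1 - \<theta> / m is negative.\<close>
    also have "\<dots> \<le> ?h k * exp (- \<theta> / m)"
      by (intro mult_left_mono exp_ge_add_one_self h0)
    finally show ?thesis .
  qed
  have nat: "?h k \<le> m * exp (- real k / m)" for k
  proof (induction k)
    case (Suc k)
    have "?h (Suc k) = (\<integral>x. max 0 (real x - (real k + 1)) \<partial>p)"
      by (intro Bochner_Integration.integral_cong refl) (auto simp: max_def of_nat_diff)
    also have "\<dots> \<le> ?h k * exp (- 1 / m)" by (rule step) auto
    also have "\<dots> \<le> m * exp (- real k / m) * exp (- 1 / m)"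
      using Suc by (intro mult_right_mono) auto
    finally show ?case by (simp add: mult.assoc exp_add[symmetric] add_divide_distrib diff_divide_distrib add.commute)
  qed (simp add: m_def)
  define k where "k = nat \<lfloor>s\<rfloor>"
  have k: "0 \<le> s - real k" "s - real k \<le> 1" using s unfolding k_def by linarith+
  have "(\<integral>x. max 0 (real x - s) \<partial>p) \<le> ?h k * exp (- (s - real k) / m)"
    using step[OF k, of k] by simp
  also have "\<dots> \<le> m * exp (- real k / m) * exp (- (s - real k) / m)"
    by (intro mult_right_mono nat) auto
  also have "\<dots> = m * exp (- s / m)"
    by (simp add: mult.assoc exp_add[symmetric] diff_divide_distrib)
  finally show ?thesis .
qed

lemma nbue_upper_tail:
  assumes p: "nbue p" and int: "integrable (measure_pmf p) real" and pos: "0 < (\<integral>x. real x \<partial>p)"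
  shows "measure p {x. t * (\<integral>x. real x \<partial>p) \<le> real x} \<le> exp (1 - t)"
proof (cases "t \<le> 1")
  case True
  \<comment> \<open>Here \<open>s\<close> below would be negative or zero, but the bound is
    trivial.\<close>
  then have "1 \<le> exp (1 - t)" by simp
  then show ?thesis using measure_pmf.prob_le_1 by (rule order_trans[rotated])
next
  case False
  let ?m = "\<integral>x. real x \<partial>p" and ?A = "{x. t * (\<integral>x. real x \<partial>p) \<le> real x}"
  \<comment> \<open>Markov's inequality for the excess over the level \<open>s\<close>, at distance exactly one mean from \<open>t * m\<close>\<close>
  define s where "s = (t - 1) * ?m"
  have s: "0 \<le> s" using False pos by (simp add: s_def)
  have "?m * measure p ?A = (\<integral>x. ?m * indicator ?A x \<partial>p)" by simp
  also have "\<dots> \<le> (\<integral>x. max 0 (real x - s) \<partial>p)"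
  proof (rule integral_mono')
    show "integrable p (\<lambda>x. max 0 (real x - s))"
      using int by (intro Bochner_Integration.integrable_max) auto
    fix x
    \<comment> \<open>On \<open>?A\<close> the excess is at least
      \<open>t * ?m - (t - 1) * ?m = ?m\<close>.\<close>
    show "?m * indicator ?A x \<le> max 0 (real x - s)"
      by (cases "x \<in> ?A") (simp_all add: s_def left_diff_distrib max_def)
  qed simp
  also have "\<dots> \<le> ?m * exp (- s / ?m)"
    by (rule nbue_excess_le[OF p int pos s])
  also have "- s / ?m = 1 - t" using pos by (simp add: s_def)
  finally show ?thesis using pos by simp
qed

section \<open>Induction over the generations\<close>

theorem theorem6:
  fixes M :: "'a measure" and \<xi> :: "nat \<Rightarrow> nat \<Rightarrow> 'a \<Rightarrow> nat" and Z :: "nat \<Rightarrow> 'a \<Rightarrow> nat"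
    and \<mu> :: real and Zstar :: "nat \<Rightarrow> real measure"
  assumes "galton_watson M \<xi> Z"
    and "integrable M (\<lambda>\<omega>. real (Z 1 \<omega>))"
    and "\<mu> = (\<integral>\<omega>. real (Z 1 \<omega>) \<partial>M)"
    and "0 < \<mu>"
    and "\<And>n. is_equilibrium (real_law M (Z n)) (Zstar n)"
    and "Zstar 1 \<preceq>\<^sub>s\<^sub>t real_law M (Z 1)"
  shows "(\<forall>n. Zstar n \<preceq>\<^sub>s\<^sub>t real_law M (Z n)) \<and>
    (\<forall>n. \<forall>t>0. measure M {\<omega> \<in> space M. real (Z n \<omega>) \<ge> t * \<mu> ^ n} \<le> exp (1 - t) \<and>
               measure M {\<omega> \<in> space M. real (Z n \<omega>) \<le> t * \<mu> ^ n} \<le> t)"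
proof -
  interpret galton_watson M \<xi> Z by fact
  have law: "real_law M (Z n) = distr (measure_pmf p) borel real"
    if "measure_pmf p = distr M (count_space UNIV) (Z n)" for n p
    unfolding that real_law_def by (subst distr_distr) (auto simp: comp_def)
  obtain q where q: "measure_pmf q = distr M (count_space UNIV) (\<xi> 0 0)"
    by (rule obtain_pmf[of "\<xi> 0 0"]) auto
  \<comment> \<open>\<open>q\<close> serves both as offspring law in the random sums and as law of
    \<open>Z 1\<close>, where the hypothesis on \<open>Zstar 1\<close> applies.\<close>
  have q1: "measure_pmf q = distr M (count_space UNIV) (Z 1)"
    unfolding q by (intro distr_cong) (auto simp: Z_1[simplified])
  have q_int: "integrable q real"
    unfolding q1 using assms(2) by (simp add: integrable_distr_eq)
  have q_mean: "(\<integral>x. real x \<partial>q) = \<mu>"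
    unfolding q1 assms(3) by (simp add: integral_distr)
  have "0 < (\<integral>x. real x \<partial>q)" unfolding q_mean by (fact assms(4))
  from equilibrium_le_iff_nbue[OF q_int this assms(5)[of 1, unfolded law[OF q1]]] have "nbue q"
    using assms(6) unfolding law[OF q1] by simp
  have q_mean': "(\<integral>\<^sup>+x. of_nat x \<partial>q) = ennreal \<mu>"
    using nn_integral_eq_integral[OF q_int] by (simp add: q_mean ennreal_of_nat_eq_real_of_nat)
  \<comment> \<open>The mean is carried along because its finiteness gives integrability of
    \<open>Z n\<close> and its value \<mu> ^ n is the scale in the tail bounds.\<close>
  have ex: "\<exists>p. measure_pmf p = distr M (count_space UNIV) (Z n) \<and> nbue p \<and>
    (\<integral>\<^sup>+x. of_nat x \<partial>p) = ennreal (\<mu> ^ n)" for n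
  proof (induction n)
    case 0
    have "distr M (count_space UNIV) (Z 0) = distr M (count_space UNIV) (\<lambda>_. 1)"
      by (intro distr_cong) (auto simp: Z_0)
    also have "\<dots> = measure_pmf (return_pmf 1)"
      by (simp add: distr_const return_pmf.rep_eq)
    finally have "measure_pmf (return_pmf 1) = distr M (count_space UNIV) (Z 0)" ..
    moreover have "(\<integral>\<^sup>+x. of_nat x \<partial>return_pmf 1) = ennreal (\<mu> ^ 0)" by simp
    ultimately show ?case using nbue_return_1 by blast
  next
    case (Suc n)
    then obtain p where p: "measure_pmf p = distr M (count_space UNIV) (Z n)" "nbue p"
      "(\<integral>\<^sup>+x. of_nat x \<partial>p) = ennreal (\<mu> ^ n)" by blast
    have "(\<integral>\<^sup>+x. of_nat x \<partial>bind_pmf p (iid_sum_pmf q)) = ennreal (\<mu> ^ Suc n)"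
      unfolding mean_random_sum p(3) q_mean'
      using \<open>0 < \<mu>\<close> by (simp add: ennreal_mult'[symmetric] mult.commute)
    with distr_Z_Suc[OF p(1) q] nbue_random_sum[OF p(2) \<open>nbue q\<close>] show ?case by blast
  qed
  have "Zstar n \<preceq>\<^sub>s\<^sub>t real_law M (Z n) \<and>
    (\<forall>t>0. measure M {\<omega> \<in> space M. real (Z n \<omega>) \<ge> t * \<mu> ^ n} \<le> exp (1 - t) \<and>
           measure M {\<omega> \<in> space M. real (Z n \<omega>) \<le> t * \<mu> ^ n} \<le> t)" for n
  proof -
    obtain p where p: "measure_pmf p = distr M (count_space UNIV) (Z n)" "nbue p"
      and m: "(\<integral>\<^sup>+x. of_nat x \<partial>p) = ennreal (\<mu> ^ n)" using ex by blast
    have m': "(\<integral>\<^sup>+x. ennreal (real x) \<partial>p) = ennreal (\<mu> ^ n)"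
      using m by (simp add: ennreal_of_nat_eq_real_of_nat)
    have int: "integrable p real"
      by (rule integrableI_nn_integral_finite[OF _ _ m']) (use \<open>0 < \<mu>\<close> in auto)
    have mean: "(\<integral>x. real x \<partial>p) = \<mu> ^ n"
      using m' \<open>0 < \<mu>\<close> by (simp add: integral_eq_nn_integral)
    then have pos: "0 < (\<integral>x. real x \<partial>p)" using \<open>0 < \<mu>\<close> by simp
    have "measure M {\<omega> \<in> space M. P (Z n \<omega>)} = measure p {x. P x}" for P
      unfolding p(1) by (subst measure_distr) (auto intro!: arg_cong2[where f=measure])
    note tail = this[of "\<lambda>x. t * \<mu> ^ n \<le> real x" for t] this[of "\<lambda>x. real x \<le> t * \<mu> ^ n" for t]
    have "Zstar n \<preceq>\<^sub>s\<^sub>t real_law M (Z n)"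
      using equilibrium_le_iff_nbue[OF int pos assms(5)[of n, unfolded law[OF p(1)]]] p(2)
      unfolding law[OF p(1)] by simp
    then show ?thesis
      using nbue_lower_tail[OF p(2) int pos] nbue_upper_tail[OF p(2) int pos]
      unfolding tail mean by blast
  qed
  then show ?thesis by blast
qed

end
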